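(* Let $1<p<\infty$, let $T=(V,E)$ be a leafless, locally finite rooted directed tree with root $o$, and let $B_\lambda$ be a weighted backward shift that is a bounded linear operator on $\operatorname{Ces}_p(T)$ and has nonzero weights (that is, $\lambda_u\in\mathbb C\setminus\{0\}$ for every $u\in V\setminus\{o\}$). Then the following assertions are equivalent: (i) $B_\lambda$ has a nonzero orbit limit point; (ii) $e_o\in L_{B_\lambda}(f)$ for some $f\in\operatorname{Ces}_p(T)$; (iii) there exist $v\in V$ and a strictly increasing sequence of positive integers $(n_k)_{k\ge1}$ such that $$c_{|v|+n_k}\,\Phi_p(|v|+n_k)\max_{u\in\operatorname{Chi}^{n_k}(v)}|\lambda(v\to u)|\longrightarrow\infty\quad(k\to\infty);$$ (iv) there exists a strictly increasing sequence of positive integers $(n_k)_{k\ge1}$ such that $$c_{n_k}\,\Phi_p(n_k)\max_{u\in\operatorname{Chi}^{n_k}(o)}|\lambda(o\to u)|\longrightarrow\infty\quad(k\to\infty).$$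
   Context: Trees. A directed tree $T=(V,E)$ has a countably infinite vertex set $V$ and edge set $E\subseteq V\times V$ such that the underlying undirected graph is connected and has no cycles, and every vertex has at most one parent (a parent of $v$ is a vertex $w$ with $(w,v)\in E$). It is rooted if it has a unique vertex $o$ (the root) without a parent. The set of children of $v$ is $\operatorname{Chi}(v)=\{u\in V:(v,u)\in E\}$; $\operatorname{Chi}^0(v)=\{v\}$ and $\operatorname{Chi}^{n+1}(v)=\bigcup_{u\in\operatorname{Chi}^n(v)}\operatorname{Chi}(u)$. The tree is locally finite if every $\operatorname{Chi}(v)$ is finite, and leafless if every $\operatorname{Chi}(v)$ is nonempty. For $v\in V$, $|v|$ is the length of the unique path from $o$ to $v$; $D_n=\{v\in V:|v|=n\}$ and $c_n=|D_n|$ (cardinality) for $n\in\mathbb N_0$. For $v\in V$, $e_v:V\to\mathbb C$ is the function with $e_v(v)=1$ and $e_v(u)=0$ for $u\ne v$. Ces\`aro space. For $f:V\to\mathbb C$ put $A_n(f)=\frac1{c_n}\sum_{v\in D_n}|f(v)|$. For $1<p<\infty$, $\operatorname{Ces}_p(T)$ is the space of all $f:V\to\mathbb C$ with $$\|f\|_{\operatorname{Ces}_p(T)}=\Biggl[\sum_{n=0}^\infty\biggl(\frac1{n+1}\sum_{r=0}^nA_r(f)\biggr)^p\Biggr]^{1/p}<\infty;$$ it is a Banach space with this norm. For $N\in\mathbb N_0$, $\Phi_p(N)=\bigl(\sum_{s=N}^\infty\frac1{(s+1)^p}\bigr)^{-1/p}$. Weighted backward shift. For a family $\lambda=(\lambda_u)_{u\in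 V\setminus\{o\}}$ of complex weights, $B_\lambda f(v)=\sum_{u\in\operatorname{Chi}(v)}\lambda_uf(u)$, $v\in V$. If $u\in\operatorname{Chi}^n(v)$ and $v=v_0,v_1,\dots,v_n=u$ is the unique path from $v$ to $u$, then $\lambda(v\to u)=\prod_{j=1}^n\lambda_{v_j}$ (so $\lambda(v\to v)=1$). Orbit limit points. For a bounded linear operator $S$ on a Banach space $X$ and $x\in X$, $L_S(x)$ is the set of all $y\in X$ such that $S^{n_k}x\to y$ in norm for some strictly increasing sequence of positive integers $(n_k)_{k\ge1}$; its elements are the orbit limit points of $x$ under $S$. The operator $S$ has a nonzero orbit limit point if $L_S(x)\setminus\{0\}\ne\varnothing$ for some $x\in X$. *)

theory Defs
  imports "HOL-Analysis.Analysis"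
begin

section \<open>Directed trees\<close>

definition adjacent :: "('v \<times> 'v) set \<Rightarrow> 'v \<Rightarrow> 'v \<Rightarrow> bool" where
  "adjacent E u v \<longleftrightarrow> (u, v) \<in> E \<or> (v, u) \<in> E"

text \<open>Paths and cycles of the underlying undirected graph, given by their vertex lists.\<close>

definition tree_path :: "'v set \<Rightarrow> ('v \<times> 'v) set \<Rightarrow> 'v \<Rightarrow> 'v list \<Rightarrow> 'v \<Rightarrow> bool" where
  "tree_path V E u xs v \<longleftrightarrow>
     xs \<noteq> [] \<and> hd xs = u \<and> last xs = v \<and> set xs \<subseteq> V \<and> distinct xs \<and> successively (adjacent E) xs"

definition simple_cycle :: "'v set \<Rightarrow> ('v \<times> 'v) set \<Rightarrow> 'v list \<Rightarrow> bool" where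
  "simple_cycle V E xs \<longleftrightarrow>
     length xs \<ge> 3 \<and> tree_path V E (hd xs) xs (last xs) \<and> adjacent E (last xs) (hd xs)"

text \<open>
  The axiom \<open>asymmetric\<close> excludes the degenerate cycles of length one (loops) and
  two (pairs of opposite edges), which \<open>simple_cycle\<close> does not cover.
\<close>

locale directed_tree =
  fixes V :: "'v set" and E :: "('v \<times> 'v) set"
  assumes countable_vertices: "countable V"
    and infinite_vertices: "infinite V"
    and edges: "E \<subseteq> V \<times> V"
    and connected: "\<And>u v. u \<in> V \<Longrightarrow> v \<in> V \<Longrightarrow> \<exists>xs. tree_path V E u xs v"
    and asymmetric: "asym E"
    and no_cycle: "\<And>xs. \<not> simple_cycle V E xs"
    and parent_unique: "\<And>v w w'. (w, v) \<in> E \<Longrightarrow> (w', v) \<in> E \<Longrightarrow> w = w'"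

locale rooted_directed_tree = directed_tree V E
  for V :: "'v set" and E :: "('v \<times> 'v) set" +
  fixes rt :: 'v
  assumes root_in: "rt \<in> V"
    and root_no_parent: "\<And>w. (w, rt) \<notin> E"
    and root_unique: "\<And>v. v \<in> V \<Longrightarrow> (\<And>w. (w, v) \<notin> E) \<Longrightarrow> v = rt"

definition Chi :: "('v \<times> 'v) set \<Rightarrow> 'v \<Rightarrow> 'v set" where
  "Chi E v = {u. (v, u) \<in> E}"

primrec Chi_iter :: "('v \<times> 'v) set \<Rightarrow> nat \<Rightarrow> 'v \<Rightarrow> 'v set" where
  "Chi_iter E 0 v = {v}"
| "Chi_iter E (Suc n) v = (\<Union>u\<in>Chi_iter E n v. Chi E u)"

definition locally_finite_tree :: "'v set \<Rightarrow> ('v \<times> 'v) set \<Rightarrow> bool" where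
  "locally_finite_tree V E \<longleftrightarrow> (\<forall>v\<in>V. finite (Chi E v))"

definition leafless_tree :: "'v set \<Rightarrow> ('v \<times> 'v) set \<Rightarrow> bool" where
  "leafless_tree V E \<longleftrightarrow> (\<forall>v\<in>V. Chi E v \<noteq> {})"

definition the_path :: "'v set \<Rightarrow> ('v \<times> 'v) set \<Rightarrow> 'v \<Rightarrow> 'v \<Rightarrow> 'v list" where
  "the_path V E u v = (THE xs. tree_path V E u xs v)"

text \<open>The length of a path is its number of edges.\<close>

definition depth :: "'v set \<Rightarrow> ('v \<times> 'v) set \<Rightarrow> 'v \<Rightarrow> 'v \<Rightarrow> nat" where
  "depth V E rt v = length (the_path V E rt v) - 1"

definition level :: "'v set \<Rightarrow> ('v \<times> 'v) set \<Rightarrow> 'v \<Rightarrow> nat \<Rightarrow> 'v set" where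
  "level V E rt n = {v \<in> V. depth V E rt v = n}"

definition level_card :: "'v set \<Rightarrow> ('v \<times> 'v) set \<Rightarrow> 'v \<Rightarrow> nat \<Rightarrow> nat" where
  "level_card V E rt n = card (level V E rt n)"

section \<open>The Cesaro space of a tree\<close>

definition level_mean :: "'v set \<Rightarrow> ('v \<times> 'v) set \<Rightarrow> 'v \<Rightarrow> nat \<Rightarrow> ('v \<Rightarrow> complex) \<Rightarrow> real" where
  "level_mean V E rt n f =
     1 / real (level_card V E rt n) * (\<Sum>v\<in>level V E rt n. cmod (f v))"

definition Ces_term ::
    "'v set \<Rightarrow> ('v \<times> 'v) set \<Rightarrow> 'v \<Rightarrow> real \<Rightarrow> ('v \<Rightarrow> complex) \<Rightarrow> nat \<Rightarrow> real" where
  "Ces_term V E rt p f n =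
     (1 / (real n + 1) * (\<Sum>j=0..n. level_mean V E rt j f)) powr p"

text \<open>Functions on \<open>V\<close> are represented by functions on the whole type that vanish off \<open>V\<close>.\<close>

definition Ces :: "'v set \<Rightarrow> ('v \<times> 'v) set \<Rightarrow> 'v \<Rightarrow> real \<Rightarrow> ('v \<Rightarrow> complex) set" where
  "Ces V E rt p = {f. (\<forall>v. v \<notin> V \<longrightarrow> f v = 0) \<and> summable (Ces_term V E rt p f)}"

definition Ces_norm :: "'v set \<Rightarrow> ('v \<times> 'v) set \<Rightarrow> 'v \<Rightarrow> real \<Rightarrow> ('v \<Rightarrow> complex) \<Rightarrow> real" where
  "Ces_norm V E rt p f = (\<Sum>n. Ces_term V E rt p f n) powr (1 / p)"

definition Phi :: "real \<Rightarrow> nat \<Rightarrow> real" where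
  "Phi p N = (\<Sum>j. 1 / (real (N + j) + 1) powr p) powr (- 1 / p)"

definition unit_fun :: "'v \<Rightarrow> 'v \<Rightarrow> complex" where
  "unit_fun v = (\<lambda>u. if u = v then 1 else 0)"

section \<open>Weighted backward shifts\<close>

text \<open>
  A weight family is a total function; its value at the root is never used below.
\<close>

definition backward_shift ::
    "('v \<times> 'v) set \<Rightarrow> ('v \<Rightarrow> complex) \<Rightarrow> ('v \<Rightarrow> complex) \<Rightarrow> 'v \<Rightarrow> complex" where
  "backward_shift E w f v = (\<Sum>u\<in>Chi E v. w u * f u)"

definition path_weight ::
    "'v set \<Rightarrow> ('v \<times> 'v) set \<Rightarrow> ('v \<Rightarrow> complex) \<Rightarrow> 'v \<Rightarrow> 'v \<Rightarrow> complex" where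
  "path_weight V E w v u = prod_list (map w (tl (the_path V E v u)))"

section \<open>Operators and orbit limit points\<close>

text \<open>
  A normed space of complex functions is given by its carrier \<open>X\<close> and its norm \<open>N\<close>,
  since the Cesaro space depends on term parameters and so cannot be a type.
\<close>

definition bounded_operator_on ::
    "('v \<Rightarrow> complex) set \<Rightarrow> (('v \<Rightarrow> complex) \<Rightarrow> real) \<Rightarrow>
     (('v \<Rightarrow> complex) \<Rightarrow> ('v \<Rightarrow> complex)) \<Rightarrow> bool" where
  "bounded_operator_on X N S \<longleftrightarrow>
     (\<forall>f\<in>X. S f \<in> X) \<and>
     (\<forall>f\<in>X. \<forall>g\<in>X. S (\<lambda>v. f v + g v) = (\<lambda>v. S f v + S g v)) \<and>
     (\<forall>a. \<forall>f\<in>X. S (\<lambda>v. a * f v) = (\<lambda>v. a * S f v)) \<and>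
     (\<exists>C. \<forall>f\<in>X. N (S f) \<le> C * N f)"

definition orbit_limit_points ::
    "('v \<Rightarrow> complex) set \<Rightarrow> (('v \<Rightarrow> complex) \<Rightarrow> real) \<Rightarrow>
     (('v \<Rightarrow> complex) \<Rightarrow> ('v \<Rightarrow> complex)) \<Rightarrow> ('v \<Rightarrow> complex) \<Rightarrow> ('v \<Rightarrow> complex) set" where
  "orbit_limit_points X N S f =
     {g \<in> X. \<exists>n :: nat \<Rightarrow> nat. strict_mono n \<and> (\<forall>k. n k > 0) \<and>
        (\<lambda>k. N (\<lambda>v. (S ^^ n k) f v - g v)) \<longlonglongrightarrow> 0}"

definition has_nonzero_orbit_limit_point ::
    "('v \<Rightarrow> complex) set \<Rightarrow> (('v \<Rightarrow> complex) \<Rightarrow> real) \<Rightarrow>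
     (('v \<Rightarrow> complex) \<Rightarrow> ('v \<Rightarrow> complex)) \<Rightarrow> bool" where
  "has_nonzero_orbit_limit_point X N S \<longleftrightarrow>
     (\<exists>f\<in>X. orbit_limit_points X N S f - {\<lambda>_. 0} \<noteq> {})"

end

theory Submission
  imports Defs
begin

text \<open>
  Write \<open>c\<^sub>m\<close> for the size of level \<open>m\<close> and \<open>\<Phi>\<^sub>p\<close> for \<open>Phi p\<close>.
  Two facts control the argument. A multiple \<open>a \<cdot> e\<^sub>u\<close> with \<open>u\<close> on level \<open>m\<close> has norm
  \<open>|a| / (c\<^sub>m \<Phi>\<^sub>p(m))\<close>, and the \<open>n\<close>-th power of the shift at \<open>v\<close> is the sum of
  \<open>\<lambda>(v \<rightarrow> u) f(u)\<close> over the descendants \<open>u\<close> of \<open>v\<close> in generation \<open>n\<close>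
  (\<open>backward_shift_funpow\<close>).

  If an orbit has a nonzero limit point, its values at some \<open>v\<close> stay away from 0 along a
  subsequence. Every \<open>f\<close> in the space has \<open>\<Sum> |f(u)| = o(c\<^sub>m \<Phi>\<^sub>p(m))\<close> over level \<open>m\<close>, since the mean over
  that level is controlled by the tail of the convergent Cesaro series (\<open>level_mean_le_Phi_tail\<close>).
  Hence \<open>c\<^sub>m \<Phi>\<^sub>p(m) max |\<lambda>(v \<rightarrow> u)|\<close> must tend to infinity along the subsequence
  (\<open>limit_point_imp_weights_unbounded\<close>). Passing from \<open>v\<close> to the root costs the constant factor
  \<open>|\<lambda>(o \<rightarrow> v)| > 0\<close> (\<open>weights_unbounded_at_root\<close>).

  Conversely, if this quantity is unbounded at the root, take vertices \<open>u\<close> of maximal path weight on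
  very sparse levels and add up the functions \<open>(1 / \<lambda>(o \<rightarrow> u)) \<cdot> e\<^sub>u\<close>, whose norms
  tend to 0. The power of the shift that belongs to one of these levels forgets the earlier summands,
  maps its own to \<open>e\<^sub>o\<close>, and leaves the later ones small because they were chosen small relative to
  the norm of that power (\<open>weights_unbounded_imp_root_limit_point\<close>). Convergence of the sum is an
  explicit estimate (\<open>sparse_in_Ces\<close>), which works because the supports lie on distinct levels.

  The paths in the definitions are undirected. Unique parents make them manageable: a downward path
  is determined by its ends, and a path without repetitions that leads to a descendant only
  runs downwards (\<open>tree_path_to_descendant_is_down_path\<close>). Hence level \<open>n\<close> is the \<open>n\<close>-th generation of
  descendants of the root, and path weights are multiplicative.
\<close>

section \<open>Paths and levels in a rooted directed tree\<close>

definition down_path :: "('v \<times> 'v) set \<Rightarrow> 'v \<Rightarrow> 'v list \<Rightarrow> 'v \<Rightarrow> bool" where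
  "down_path E u xs v \<longleftrightarrow>
     xs \<noteq> [] \<and> hd xs = u \<and> last xs = v \<and> successively (\<lambda>a b. (a, b) \<in> E) xs"

lemma down_path_singleton: "down_path E v [v] v"
  by (simp add: down_path_def)

lemma down_path_Cons: "(z, v) \<in> E \<Longrightarrow> down_path E v xs u \<Longrightarrow> down_path E z (z # xs) u"
  by (auto simp: down_path_def successively_Cons)

lemma down_path_snoc: "down_path E v xs x \<Longrightarrow> (x, u) \<in> E \<Longrightarrow> down_path E v (xs @ [u]) u"
  by (auto simp: down_path_def successively_append_iff)

lemma down_path_append:
  assumes "down_path E v xs x" "down_path E x ys u"
  shows "down_path E v (xs @ tl ys) u"
proof (cases ys)
  case Nil
  then show ?thesis using assms by (simp add: down_path_def)
next
  case (Cons y zs)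
  then show ?thesis using assms
    by (auto simp: down_path_def successively_append_iff successively_Cons)
qed

lemma down_path_butlast:
  assumes "down_path E v xs u" "length xs = Suc (Suc n)"
  obtains ys x where "xs = ys @ [u]" "down_path E v ys x" "(x, u) \<in> E" "length ys = Suc n"
proof -
  have xs: "xs = butlast xs @ [u]"
    using assms(1) append_butlast_last_id[of xs] by (auto simp: down_path_def)
  have ne: "butlast xs \<noteq> []"
    using assms(2) by (auto simp flip: length_greater_0_conv)
  have suc: "successively (\<lambda>a b. (a, b) \<in> E) (butlast xs @ [u])"
    using assms(1) xs by (simp add: down_path_def)
  have hd: "hd (butlast xs @ [u]) = v"
    using assms(1) xs by (simp add: down_path_def)
  have "down_path E v (butlast xs) (last (butlast xs))" "(last (butlast xs), u) \<in> E"
    using ne suc hd unfolding down_path_def by (auto simp: successively_append_iff)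
  then show ?thesis
    using that[OF xs] assms(2) by simp
qed

lemma Chi_iter_iff_down_path:
  "u \<in> Chi_iter E n v \<longleftrightarrow> (\<exists>xs. down_path E v xs u \<and> length xs = Suc n)"
proof (induction n arbitrary: u)
  case 0
  have "u = v" if "down_path E v xs u" "length xs = Suc 0" for xs
    using that by (auto simp: down_path_def length_Suc_conv)
  moreover have "\<exists>xs. down_path E v xs v \<and> length xs = Suc 0"
    using down_path_singleton[of E v] by (intro exI[of _ "[v]"]) simp
  ultimately show ?case by auto
next
  case (Suc n)
  show ?case
  proof
    assume "u \<in> Chi_iter E (Suc n) v"
    then obtain x where "x \<in> Chi_iter E n v" "(x, u) \<in> E" by (auto simp: Chi_def)
    then obtain xs where "down_path E v xs x" "length xs = Suc n" using Suc.IH by blast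
    with \<open>(x, u) \<in> E\<close> show "\<exists>xs. down_path E v xs u \<and> length xs = Suc (Suc n)"
      by (intro exI[of _ "xs @ [u]"]) (auto intro: down_path_snoc)
  next
    assume "\<exists>xs. down_path E v xs u \<and> length xs = Suc (Suc n)"
    then obtain xs where "down_path E v xs u" "length xs = Suc (Suc n)" by blast
    then obtain ys x where "down_path E v ys x" "(x, u) \<in> E" "length ys = Suc n"
      by (rule down_path_butlast)
    then show "u \<in> Chi_iter E (Suc n) v" using Suc.IH by (auto simp: Chi_def)
  qed
qed

lemma (in directed_tree) finite_Chi_iter:
  assumes "locally_finite_tree V E" "v \<in> V"
  shows "finite (Chi_iter E n v) \<and> Chi_iter E n v \<subseteq> V"
proof (induction n)
  case (Suc n)
  then show ?case using assms edges by (auto simp: locally_finite_tree_def Chi_def)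
qed (use assms in auto)

lemma (in directed_tree) Chi_iter_nonempty:
  assumes "leafless_tree V E" "v \<in> V"
  shows "\<exists>u\<in>V. u \<in> Chi_iter E n v"
proof (induction n)
  case (Suc n)
  then obtain x where x: "x \<in> V" "x \<in> Chi_iter E n v" by blast
  then obtain u where "u \<in> Chi E x" using assms by (auto simp: leafless_tree_def)
  moreover from this have "u \<in> V" using edges by (auto simp: Chi_def)
  ultimately show ?case using x by auto
qed (use assms in auto)

text \<open>
  Read from its end, a downward path is forced, because parents are unique.
\<close>

lemma (in directed_tree) down_path_suffix:
  assumes "down_path E x xs u" "down_path E y ys u" "length xs \<le> length ys"
  shows "\<exists>zs. ys = zs @ xs"
  using assms
proof (induction "length xs" arbitrary: xs ys u)
  case 0
  then show ?case by (simp add: down_path_def)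
next
  case (Suc n)
  show ?case
  proof (cases n)
    case 0
    then have "length xs = 1" using Suc.hyps by simp
    then have "xs = [u]" using Suc.prems(1) by (auto simp: length_Suc_conv down_path_def)
    moreover have "ys = butlast ys @ [u]"
      using Suc.prems(2) append_butlast_last_id[of ys] by (auto simp: down_path_def)
    ultimately show ?thesis by blast
  next
    case (Suc m)
    then have len: "length xs = Suc (Suc m)" using Suc.hyps by simp
    then have len': "length ys = Suc (Suc (length ys - 2))" using Suc.prems(3) by simp
    from down_path_butlast[OF Suc.prems(1) len] obtain xs' a where
      xs: "xs = xs' @ [u]" "down_path E x xs' a" "(a, u) \<in> E" "length xs' = Suc m" .
    from down_path_butlast[OF Suc.prems(2) len'] obtain ys' b where
      ys: "ys = ys' @ [u]" "down_path E y ys' b" "(b, u) \<in> E" "length ys' = Suc (length ys - 2)" .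
    have ab: "a = b" using parent_unique xs(3) ys(3) by blast
    have "\<exists>zs. ys' = zs @ xs'"
    proof (rule Suc.hyps(1))
      show "n = length xs'" using xs(4) Suc by simp
      show "down_path E x xs' a" by (fact xs(2))
      show "down_path E y ys' a" using ys(2) ab by simp
      show "length xs' \<le> length ys'" using xs(4) ys(4) len Suc.prems(3) by linarith
    qed
    then show ?thesis using xs(1) ys(1) by auto
  qed
qed

text \<open>
  A path that avoids repetitions cannot turn upwards after a downward step, because the only way
  up is back along the edge just used.
\<close>

lemma (in directed_tree) down_first_imp_down:
  assumes "successively (adjacent E) (v # z # xs)" "distinct (v # z # xs)" "(v, z) \<in> E"
  shows "successively (\<lambda>a b. (a, b) \<in> E) (v # z # xs)"
  using assms
proof (induction xs arbitrary: v z)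
  case (Cons y xs)
  have "(z, y) \<in> E"
    using Cons.prems parent_unique by (auto simp: adjacent_def)
  moreover have "successively (\<lambda>a b. (a, b) \<in> E) (z # y # xs)"
    by (rule Cons.IH) (use Cons.prems \<open>(z, y) \<in> E\<close> in auto)
  ultimately show ?case using Cons.prems by simp
qed simp

context rooted_directed_tree
begin

lemma root_path_exists:
  assumes "v \<in> V"
  shows "\<exists>xs. down_path E rt xs v \<and> distinct xs \<and> set xs \<subseteq> V"
proof -
  obtain xs where xs: "tree_path V E rt xs v" using connected root_in assms by blast
  have "successively (\<lambda>a b. (a, b) \<in> E) xs"
  proof (cases xs)
    case (Cons a ys)
    show ?thesis
    proof (cases ys)
      case (Cons b zs)
      note eq = \<open>xs = a # ys\<close> Cons
      have "(a, b) \<in> E"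
        using xs root_no_parent unfolding eq by (auto simp: tree_path_def adjacent_def)
      then show ?thesis
        using xs down_first_imp_down[of a b zs] unfolding eq by (auto simp: tree_path_def)
    qed (use Cons in simp)
  qed simp
  then show ?thesis using xs by (auto simp: tree_path_def down_path_def)
qed

text \<open>
  Since the root has no parent, the path from the root is the longest downward path that ends at
  a given vertex.
\<close>

lemma down_path_suffix_of_root_path:
  assumes "down_path E x xs u" "down_path E rt ps u"
  shows "\<exists>zs. ps = zs @ xs"
proof (cases "length xs \<le> length ps")
  case True
  then show ?thesis using down_path_suffix assms by blast
next
  case False
  then obtain zs where zs: "xs = zs @ ps" using down_path_suffix[OF assms(2,1)] by auto
  then have "zs \<noteq> []" using False by auto
  then have "(last zs, rt) \<in> E"
    using assms zs by (auto simp: down_path_def successively_append_iff)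
  then show ?thesis using root_no_parent by blast
qed

lemma down_path_imp_tree_path:
  assumes "down_path E x xs u" "u \<in> V"
  shows "tree_path V E x xs u"
proof -
  obtain ps where ps: "down_path E rt ps u" "distinct ps" "set ps \<subseteq> V"
    using root_path_exists assms(2) by blast
  then obtain zs where "ps = zs @ xs" using down_path_suffix_of_root_path assms(1) by blast
  moreover have "successively (adjacent E) xs"
    using assms(1) unfolding down_path_def
    by (auto simp: adjacent_def elim: successively_mono)
  ultimately show ?thesis using ps assms(1) by (auto simp: tree_path_def down_path_def)
qed

lemma down_path_unique:
  assumes "down_path E x xs u" "down_path E x ys u" "u \<in> V"
  shows "xs = ys"
proof -
  have aux: "xs = ys"
    if "down_path E x xs u" "down_path E x ys u" "length xs \<le> length ys" for xs ys
  proof -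
    from that obtain zs where zs: "ys = zs @ xs" using down_path_suffix by blast
    have "distinct ys" "hd ys = x" "xs \<noteq> []" "hd xs = x"
      using down_path_imp_tree_path[OF that(2) assms(3)] that by (auto simp: tree_path_def down_path_def)
    then have "zs = []"
      using zs by (cases zs) (auto dest: hd_in_set)
    then show ?thesis using zs by simp
  qed
  show ?thesis
  proof (cases "length xs \<le> length ys")
    case True
    with assms show ?thesis by (intro aux)
  next
    case False
    then have "ys = xs" using assms by (intro aux) auto
    then show ?thesis ..
  qed
qed

text \<open>
  If a path from \<open>x\<close> to a descendant began with a step up to \<open>z\<close>, then its rest would be a
  downward path by induction; but so is the path from \<open>z\<close> down through \<open>x\<close>, and by uniqueness
  the two agree, so that \<open>x\<close> would be visited twice.
\<close>

lemma tree_path_to_descendant_is_down_path: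
  assumes "down_path E x xs u" "tree_path V E x ys u" "u \<in> V"
  shows "down_path E x ys u"
  using assms(1,2)
proof (induction ys arbitrary: x xs)
  case Nil
  then show ?case by (simp add: tree_path_def)
next
  case (Cons a ys)
  have a: "a = x" using Cons.prems by (simp add: tree_path_def)
  show ?case
  proof (cases ys)
    case Nil
    then show ?thesis using Cons.prems by (auto simp: tree_path_def down_path_def)
  next
    case (Cons z zs)
    note tp = Cons.prems(2)[unfolded a \<open>ys = z # zs\<close>]
    have sub: "tree_path V E z ys u" using tp Cons by (auto simp: tree_path_def)
    have "(x, z) \<in> E \<or> (z, x) \<in> E" using tp by (auto simp: tree_path_def adjacent_def)
    then show ?thesis
    proof
      assume "(x, z) \<in> E"
      then show ?thesis
        using tp down_first_imp_down[of x z zs] unfolding a Cons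
        by (auto simp: tree_path_def down_path_def)
    next
      assume "(z, x) \<in> E"
      then have dp: "down_path E z (z # xs) u" using Cons.prems(1) by (rule down_path_Cons)
      then have "ys = z # xs"
        using down_path_unique[OF _ dp assms(3)] Cons.IH[OF dp sub] by blast
      moreover have "x \<in> set xs" using Cons.prems(1) by (auto simp: down_path_def)
      ultimately show ?thesis using tp Cons by (auto simp: tree_path_def)
    qed
  qed
qed

lemma the_path_eq:
  assumes "down_path E x xs u" "u \<in> V"
  shows "the_path V E x u = xs"
  unfolding the_path_def
proof (rule the_equality)
  show "tree_path V E x xs u" using assms by (rule down_path_imp_tree_path)
  show "ys = xs" if "tree_path V E x ys u" for ys
    using down_path_unique[OF _ assms] tree_path_to_descendant_is_down_path[OF assms(1) that assms(2)]
    by blast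
qed

lemma level_eq_Chi_iter: "level V E rt n = V \<inter> Chi_iter E n rt"
proof -
  have "depth V E rt v = n \<longleftrightarrow> v \<in> Chi_iter E n rt" if v: "v \<in> V" for v
  proof -
    obtain xs where xs: "down_path E rt xs v" using root_path_exists v by blast
    then have len: "length xs = Suc (depth V E rt v)"
      using the_path_eq[OF xs v] by (auto simp: depth_def down_path_def)
    have "v \<in> Chi_iter E n rt \<longleftrightarrow> length xs = Suc n"
      unfolding Chi_iter_iff_down_path using xs down_path_unique[OF xs _ v] by blast
    then show ?thesis using len by auto
  qed
  then show ?thesis by (auto simp: level_def)
qed

lemma in_Chi_iter_depth: "v \<in> V \<Longrightarrow> v \<in> Chi_iter E (depth V E rt v) rt"
  using level_eq_Chi_iter[of "depth V E rt v"] by (auto simp: level_def)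

lemma depth_root: "depth V E rt rt = 0"
  using level_eq_Chi_iter[of 0] root_in by (auto simp: level_def)

lemma depth_0_iff: "v \<in> V \<Longrightarrow> depth V E rt v = 0 \<longleftrightarrow> v = rt"
  using in_Chi_iter_depth[of v] depth_root by auto

lemma path_weight_self: "v \<in> V \<Longrightarrow> path_weight V E w v v = 1"
  using the_path_eq[OF down_path_singleton] by (simp add: path_weight_def)

lemma Chi_iter_trans:
  assumes "x \<in> Chi_iter E m v" "u \<in> Chi_iter E n x"
  shows "u \<in> Chi_iter E (m + n) v"
proof -
  obtain xs where "down_path E v xs x" "length xs = Suc m"
    using Chi_iter_iff_down_path assms by metis
  moreover obtain ys where "down_path E x ys u" "length ys = Suc n"
    using Chi_iter_iff_down_path assms by metis
  ultimately show ?thesis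
    unfolding Chi_iter_iff_down_path by (intro exI[of _ "xs @ tl ys"]) (auto intro: down_path_append)
qed

lemma path_weight_trans:
  assumes "x \<in> Chi_iter E m v" "u \<in> Chi_iter E n x" "x \<in> V" "u \<in> V"
  shows "path_weight V E w v u = path_weight V E w v x * path_weight V E w x u"
proof -
  obtain xs where xs: "down_path E v xs x" using Chi_iter_iff_down_path assms by metis
  obtain ys where ys: "down_path E x ys u" using Chi_iter_iff_down_path assms by metis
  have "tl (xs @ tl ys) = tl xs @ tl ys" using xs by (auto simp: down_path_def)
  then show ?thesis
    using the_path_eq[OF xs] the_path_eq[OF ys] the_path_eq[OF down_path_append[OF xs ys]] assms
    by (simp add: path_weight_def)
qed

lemma path_weight_child:
  assumes "(x, u) \<in> E"
  shows "path_weight V E w x u = w u"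
proof -
  have "down_path E x [x, u] u" using assms by (simp add: down_path_def)
  moreover have "u \<in> V" using assms edges by auto
  ultimately show ?thesis by (simp add: path_weight_def the_path_eq)
qed

lemma path_weight_nonzero:
  assumes "u \<in> Chi_iter E n v" "v \<in> V" "\<forall>x \<in> V - {rt}. w x \<noteq> 0"
  shows "path_weight V E w v u \<noteq> 0"
proof -
  have "u \<in> V \<and> path_weight V E w v u \<noteq> 0"
    using assms(1)
  proof (induction n arbitrary: u)
    case 0
    then show ?case using assms(2) by (simp add: path_weight_self)
  next
    case (Suc n)
    then obtain x where x: "x \<in> Chi_iter E n v" "(x, u) \<in> E" by (auto simp: Chi_def)
    then have IH: "x \<in> V" "path_weight V E w v x \<noteq> 0" using Suc.IH by auto
    have u: "u \<in> V - {rt}" using x(2) edges root_no_parent by auto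
    have "u \<in> Chi_iter E 1 x" using x(2) by (simp add: Chi_def)
    then have "path_weight V E w v u = path_weight V E w v x * w u"
      using path_weight_trans[OF x(1), of u 1 w] path_weight_child[OF x(2)] IH u by simp
    then show ?case using IH u assms(3) by auto
  qed
  then show ?thesis ..
qed

text \<open>
  Since parents are unique, each vertex of a generation arises from exactly one vertex of the
  previous generation, and one more application of the shift only regroups the sum.
\<close>

lemma backward_shift_funpow:
  assumes "locally_finite_tree V E" "v \<in> V"
  shows "(backward_shift E w ^^ n) f v = (\<Sum>u\<in>Chi_iter E n v. path_weight V E w v u * f u)"
proof (induction n arbitrary: f)
  case 0
  then show ?case using assms by (simp add: path_weight_self)
next
  case (Suc n)
  have fin: "finite (Chi_iter E n v)" and sub: "Chi_iter E n v \<subseteq> V"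
    using finite_Chi_iter[OF assms] by auto
  have "(backward_shift E w ^^ Suc n) f v = (backward_shift E w ^^ n) (backward_shift E w f) v"
    by (simp add: funpow_swap1)
  also have "\<dots> = (\<Sum>x\<in>Chi_iter E n v. path_weight V E w v x * (\<Sum>u\<in>Chi E x. w u * f u))"
    by (simp add: Suc.IH backward_shift_def)
  also have "\<dots> = (\<Sum>x\<in>Chi_iter E n v. \<Sum>u\<in>Chi E x. path_weight V E w v u * f u)"
  proof (intro sum.cong refl, unfold sum_distrib_left, intro sum.cong refl)
    fix x u assume x: "x \<in> Chi_iter E n v" and u: "u \<in> Chi E x"
    have "u \<in> V" "u \<in> Chi_iter E 1 x" "(x, u) \<in> E" using u edges by (auto simp: Chi_def)
    then have "path_weight V E w v u = path_weight V E w v x * w u"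
      using path_weight_trans[OF x] path_weight_child sub x by (metis subsetD)
    then show "path_weight V E w v x * (w u * f u) = path_weight V E w v u * f u" by simp
  qed
  also have "\<dots> = (\<Sum>u\<in>(\<Union>x\<in>Chi_iter E n v. Chi E x). path_weight V E w v u * f u)"
  proof (rule sum.UNION_disjoint[symmetric])
    show "\<forall>x\<in>Chi_iter E n v. finite (Chi E x)"
      using sub assms(1) by (auto simp: locally_finite_tree_def)
    show "\<forall>x\<in>Chi_iter E n v. \<forall>y\<in>Chi_iter E n v. x \<noteq> y \<longrightarrow> Chi E x \<inter> Chi E y = {}"
      using parent_unique by (auto simp: Chi_def)
  qed (fact fin)
  finally show ?case by simp
qed

end

section \<open>Estimates in the Cesaro norm\<close>

text \<open>
  A geometric loss in the summands replaces the triangle inequality in \<open>\<ell>\<^sup>p\<close>: each \<open>x j\<close> is at most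
  \<open>S powr (1 / p) / 2 ^ (j + 1)\<close>, where \<open>S\<close> is the right-hand side.
\<close>

lemma sum_powr_le_sum_geometric:
  fixes x :: "nat \<Rightarrow> real"
  assumes "p > 0" "\<And>j. x j \<ge> 0"
  shows "(\<Sum>j\<le>n. x j) powr p \<le> (\<Sum>j\<le>n. (2 ^ Suc j * x j) powr p)"
proof -
  define S where "S = (\<Sum>j\<le>n. (2 ^ Suc j * x j) powr p)"
  have S0: "S \<ge> 0" unfolding S_def by (intro sum_nonneg) auto
  have term_le: "x j \<le> S powr (1 / p) * (1 / 2) ^ Suc j" if "j \<le> n" for j
  proof -
    have "(2 ^ Suc j * x j) powr p \<le> S"
      unfolding S_def by (rule member_le_sum) (use that in auto)
    then have "((2 ^ Suc j * x j) powr p) powr (1 / p) \<le> S powr (1 / p)"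
      using assms(1) by (intro powr_mono2) auto
    then have "2 ^ Suc j * x j \<le> S powr (1 / p)"
      using assms by (simp add: powr_powr)
    then show ?thesis by (simp add: field_simps)
  qed
  have "(\<Sum>j\<le>n. (1 / 2 :: real) ^ Suc j) = 1 - (1 / 2) ^ Suc n"
    by (induction n) (auto simp: field_simps)
  then have half: "(\<Sum>j\<le>n. (1 / 2 :: real) ^ Suc j) \<le> 1" by simp
  have "(\<Sum>j\<le>n. x j) \<le> (\<Sum>j\<le>n. S powr (1 / p) * (1 / 2) ^ Suc j)"
    by (intro sum_mono term_le) simp
  also have "\<dots> = S powr (1 / p) * (\<Sum>j\<le>n. (1 / 2) ^ Suc j)"
    by (simp only: sum_distrib_left)
  also have "\<dots> \<le> S powr (1 / p)"
    using half by (intro mult_left_le) auto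
  finally have "(\<Sum>j\<le>n. x j) powr p \<le> (S powr (1 / p)) powr p"
    using assms by (intro powr_mono2 sum_nonneg) auto
  also have "\<dots> = S" using assms(1) S0 by (simp add: powr_powr)
  finally show ?thesis by (simp add: S_def)
qed

lemma summable_Phi:
  assumes "1 < p"
  shows "summable (\<lambda>j. 1 / (real (N + j) + 1) powr p)"
proof -
  have "summable (\<lambda>n. real n powr (- p))"
    using assms by (simp add: summable_real_powr_iff)
  then have "summable (\<lambda>j. real (j + Suc N) powr (- p))"
    by (rule summable_ignore_initial_segment)
  then show ?thesis by (simp add: powr_minus divide_inverse add_ac)
qed

lemma Phi_series_pos:
  assumes "1 < p"
  shows "(\<Sum>j. 1 / (real (N + j) + 1) powr p) > 0"
  by (intro suminf_pos summable_Phi assms) auto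

lemma Phi_pos: "1 < p \<Longrightarrow> Phi p N > 0"
  using Phi_series_pos[of p N] by (simp add: Phi_def)

lemma Phi_powr:
  assumes "1 < p"
  shows "Phi p N powr p = 1 / (\<Sum>j. 1 / (real (N + j) + 1) powr p)"
proof -
  have "(Z powr (- 1 / p)) powr p = 1 / Z" if "Z > 0" for Z :: real
    unfolding powr_powr using that assms by (simp add: powr_minus_divide)
  then show ?thesis unfolding Phi_def using Phi_series_pos[OF assms] .
qed

lemma sum_Phi_div_powr_le_1:
  assumes "1 < p"
  shows "(\<Sum>n\<in>{N..<M}. (Phi p N / (real n + 1)) powr p) \<le> 1"
proof -
  let ?Z = "\<Sum>j. 1 / (real (N + j) + 1) powr p"
  have "(\<Sum>n\<in>{N..<M}. 1 / (real n + 1) powr p) = (\<Sum>j<M - N. 1 / (real (N + j) + 1) powr p)"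
    by (rule sum.reindex_bij_witness[of _ "\<lambda>j. N + j" "\<lambda>n. n - N"]) auto
  also have "\<dots> \<le> ?Z"
    by (intro sum_le_suminf summable_Phi assms) auto
  finally have "(\<Sum>n\<in>{N..<M}. 1 / (real n + 1) powr p) \<le> ?Z" .
  then have "1 / ?Z * (\<Sum>n\<in>{N..<M}. 1 / (real n + 1) powr p) \<le> 1"
    using Phi_series_pos[OF assms, of N] by (simp add: field_simps)
  also have "1 / ?Z * (\<Sum>n\<in>{N..<M}. 1 / (real n + 1) powr p)
      = (\<Sum>n\<in>{N..<M}. (Phi p N / (real n + 1)) powr p)"
    using Phi_pos[OF assms, of N]
    by (simp add: powr_divide Phi_powr[OF assms] sum_distrib_left less_imp_le)
  finally show ?thesis .
qed

lemma level_mean_nonneg: "level_mean V E rt n f \<ge> 0"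
  by (simp add: level_mean_def sum_nonneg)

lemma Ces_term_nonneg: "Ces_term V E rt p f n \<ge> 0"
  by (simp add: Ces_term_def)

lemma Ces_term_diff_le:
  assumes "p > 0"
  shows "Ces_term V E rt p (\<lambda>v. f v - g v) n \<le> 2 powr p * (Ces_term V E rt p f n + Ces_term V E rt p g n)"
proof -
  have mean: "level_mean V E rt j (\<lambda>v. f v - g v) \<le> level_mean V E rt j f + level_mean V E rt j g" for j
    unfolding level_mean_def distrib_left[symmetric] sum.distrib[symmetric]
    by (intro mult_left_mono sum_mono norm_triangle_ineq4) auto
  let ?H = "\<lambda>h. 1 / (real n + 1) * (\<Sum>j=0..n. level_mean V E rt j h)"
  have nonneg: "?H h \<ge> 0" for h by (intro mult_nonneg_nonneg sum_nonneg level_mean_nonneg) auto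
  have "?H (\<lambda>v. f v - g v) \<le> ?H f + ?H g"
    unfolding distrib_left[symmetric] sum.distrib[symmetric]
    by (intro mult_left_mono sum_mono mean) auto
  also have "\<dots> \<le> 2 * max (?H f) (?H g)" by simp
  finally have "?H (\<lambda>v. f v - g v) powr p \<le> (2 * max (?H f) (?H g)) powr p"
    using nonneg assms by (intro powr_mono2) auto
  also have "\<dots> = 2 powr p * max (?H f) (?H g) powr p"
    by (rule powr_mult)
  also have "max (?H f) (?H g) powr p \<le> ?H f powr p + ?H g powr p"
    by (auto simp: max_def)
  finally show ?thesis by (simp add: Ces_term_def)
qed

lemma Ces_diff:
  assumes "p > 0" "f \<in> Ces V E rt p" "g \<in> Ces V E rt p"
  shows "(\<lambda>v. f v - g v) \<in> Ces V E rt p"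
proof -
  have "summable (\<lambda>n. 2 powr p * (Ces_term V E rt p f n + Ces_term V E rt p g n))"
    using assms by (intro summable_mult summable_add) (auto simp: Ces_def)
  then have "summable (Ces_term V E rt p (\<lambda>v. f v - g v))"
    by (rule summable_comparison_test'[where N = 0])
      (simp add: Ces_term_diff_le[OF assms(1)] abs_of_nonneg[OF Ces_term_nonneg])
  then show ?thesis using assms by (auto simp: Ces_def)
qed

text \<open>
  The mean over level \<open>N\<close> enters all terms of the Cesaro series from the \<open>N\<close>-th on. The series
  that defines \<open>Phi p N\<close> is what remains when that mean is factored out.
\<close>

lemma level_mean_le_Phi_tail:
  assumes "1 < p" "f \<in> Ces V E rt p"
  shows "level_mean V E rt N f \<le> Phi p N * (\<Sum>j. Ces_term V E rt p f (j + N)) powr (1 / p)"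
proof -
  let ?A = "level_mean V E rt N f" and ?Z = "\<Sum>j. 1 / (real (N + j) + 1) powr p"
  let ?T = "\<Sum>j. Ces_term V E rt p f (j + N)"
  have Z: "?Z > 0" by (rule Phi_series_pos[OF assms(1)])
  have sT: "summable (\<lambda>j. Ces_term V E rt p f (j + N))"
    using assms(2) by (intro summable_ignore_initial_segment) (simp add: Ces_def)
  have "?A powr p * ?Z = (\<Sum>j. ?A powr p * (1 / (real (N + j) + 1) powr p))"
    by (rule suminf_mult[symmetric]) (rule summable_Phi[OF assms(1)])
  also have "\<dots> \<le> ?T"
  proof (rule suminf_le[OF _ summable_mult[OF summable_Phi[OF assms(1)]] sT])
    fix j
    have "?A \<le> (\<Sum>i=0..N + j. level_mean V E rt i f)"
      by (rule member_le_sum) (auto simp: level_mean_nonneg)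
    then have "(1 / (real (N + j) + 1) * ?A) powr p \<le> Ces_term V E rt p f (N + j)"
      unfolding Ces_term_def using assms(1)
      by (intro powr_mono2 mult_left_mono) (auto intro!: divide_nonneg_nonneg level_mean_nonneg)
    then show "?A powr p * (1 / (real (N + j) + 1) powr p) \<le> Ces_term V E rt p f (j + N)"
      using level_mean_nonneg by (simp add: powr_divide add.commute)
  qed
  finally have "?A powr p \<le> 1 / ?Z * ?T" using Z by (simp add: field_simps)
  also have "\<dots> = Phi p N powr p * ?T" by (simp only: Phi_powr[OF assms(1)])
  finally have "(?A powr p) powr (1 / p) \<le> (Phi p N powr p * ?T) powr (1 / p)"
    using assms(1) by (intro powr_mono2) auto
  also have "\<dots> = (Phi p N powr p) powr (1 / p) * ?T powr (1 / p)"
    by (rule powr_mult)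
  finally show ?thesis
    using assms(1) level_mean_nonneg Phi_pos[OF assms(1), of N] by (simp add: powr_powr less_imp_le)
qed

lemma Ces_tail_tendsto_0:
  assumes "1 < p" "f \<in> Ces V E rt p"
  shows "(\<lambda>N. (\<Sum>j. Ces_term V E rt p f (j + N)) powr (1 / p)) \<longlonglongrightarrow> 0"
proof -
  have s: "summable (Ces_term V E rt p f)" using assms(2) by (simp add: Ces_def)
  have "(\<lambda>N. suminf (Ces_term V E rt p f) - (\<Sum>j<N. Ces_term V E rt p f j)) \<longlonglongrightarrow>
      suminf (Ces_term V E rt p f) - suminf (Ces_term V E rt p f)"
    by (intro tendsto_diff tendsto_const summable_LIMSEQ s)
  then have "(\<lambda>N. \<Sum>j. Ces_term V E rt p f (j + N)) \<longlonglongrightarrow> 0"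
    by (simp add: suminf_minus_initial_segment[OF s])
  then show ?thesis
    using assms(1) s Ces_term_nonneg
    by (intro tendsto_zero_powrI[where b = "1 / p"])
      (auto intro!: always_eventually suminf_nonneg summable_ignore_initial_segment)
qed

context rooted_directed_tree
begin

lemma finite_level: "locally_finite_tree V E \<Longrightarrow> finite (level V E rt n)"
  using finite_Chi_iter[OF _ root_in] by (simp add: level_eq_Chi_iter)

lemma level_card_pos:
  assumes "locally_finite_tree V E" "leafless_tree V E"
  shows "level_card V E rt n > 0"
proof -
  have "level V E rt n \<noteq> {}"
    using Chi_iter_nonempty[OF assms(2) root_in, of n] by (auto simp: level_eq_Chi_iter)
  then show ?thesis using finite_level[OF assms(1)] by (simp add: level_card_def card_gt_0_iff)
qed

lemma sum_level_eq:
  assumes "locally_finite_tree V E" "leafless_tree V E"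
  shows "(\<Sum>v\<in>level V E rt n. cmod (f v)) = real (level_card V E rt n) * level_mean V E rt n f"
  using level_card_pos[OF assms, of n] by (simp add: level_mean_def)

lemma Ces_point_bound:
  assumes "locally_finite_tree V E" "leafless_tree V E" "1 < p" "f \<in> Ces V E rt p" "v \<in> V"
  shows "cmod (f v) \<le> real (level_card V E rt (depth V E rt v)) * Phi p (depth V E rt v)
    * Ces_norm V E rt p f"
proof -
  let ?N = "depth V E rt v"
  have s: "summable (Ces_term V E rt p f)" using assms(4) by (simp add: Ces_def)
  have "cmod (f v) \<le> (\<Sum>v\<in>level V E rt ?N. cmod (f v))"
    using assms(5) by (intro member_le_sum finite_level assms) (auto simp: level_def)
  also have "\<dots> = real (level_card V E rt ?N) * level_mean V E rt ?N f"
    by (rule sum_level_eq[OF assms(1,2)])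
  also have "level_mean V E rt ?N f \<le> Phi p ?N * (\<Sum>j. Ces_term V E rt p f (j + ?N)) powr (1 / p)"
    by (rule level_mean_le_Phi_tail[OF assms(3,4)])
  also have "(\<Sum>j. Ces_term V E rt p f (j + ?N)) powr (1 / p) \<le> Ces_norm V E rt p f"
    unfolding Ces_norm_def
  proof (rule powr_mono2)
    show "(\<Sum>j. Ces_term V E rt p f (j + ?N)) \<le> suminf (Ces_term V E rt p f)"
      using Ces_term_nonneg[of V E rt p f]
      by (simp add: suminf_minus_initial_segment[OF s] sum_nonneg)
    show "(\<Sum>j. Ces_term V E rt p f (j + ?N)) \<ge> 0"
      using Ces_term_nonneg[of V E rt p f]
      by (intro suminf_nonneg summable_ignore_initial_segment s) auto
  qed (use assms in auto)
  finally show ?thesis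
    using Phi_pos[OF assms(3), of ?N] by (simp add: mult_left_mono mult.assoc)
qed

end

section \<open>From orbit limit points to growth of the weights\<close>

lemma bounded_operator_funpow:
  assumes "bounded_operator_on X N S" "\<And>f. N f \<ge> 0"
  shows "\<exists>C\<ge>1. \<forall>n. \<forall>f\<in>X. (S ^^ n) f \<in> X \<and> N ((S ^^ n) f) \<le> C ^ n * N f"
proof -
  obtain C0 where C0: "\<forall>f\<in>X. N (S f) \<le> C0 * N f" and X: "\<forall>f\<in>X. S f \<in> X"
    using assms(1) by (auto simp: bounded_operator_on_def)
  define C where "C = max 1 C0"
  have "(S ^^ n) f \<in> X \<and> N ((S ^^ n) f) \<le> C ^ n * N f" if f: "f \<in> X" for n f
  proof (induction n)
    case (Suc n)
    have "N (S ((S ^^ n) f)) \<le> C0 * N ((S ^^ n) f)" using Suc C0 by blast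
    also have "\<dots> \<le> C * N ((S ^^ n) f)"
      using assms(2) by (intro mult_right_mono) (auto simp: C_def)
    also have "\<dots> \<le> C * (C ^ n * N f)"
      using Suc by (intro mult_left_mono) (auto simp: C_def)
    finally show ?case using Suc X by (simp add: mult.assoc)
  qed (use f in auto)
  then show ?thesis by (intro exI[of _ C]) (auto simp: C_def)
qed

lemma Ces_norm_nonneg: "Ces_norm V E rt p f \<ge> 0"
  by (simp add: Ces_norm_def)

context rooted_directed_tree
begin

text \<open>
  The values of \<open>f\<close> on the \<open>n\<close>-th generation of descendants of \<open>v\<close> all lie on one level, so their
  sum is \<open>o(c\<^sub>m \<Phi>\<^sub>p(m))\<close> with \<open>m = |v| + n\<close>. This bound and the formula for the powers
  of the shift make the largest path weight the only quantity that can keep the orbit away from 0.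
\<close>

lemma funpow_shift_bound:
  assumes "locally_finite_tree V E" "leafless_tree V E" "1 < p" "f \<in> Ces V E rt p" "v \<in> V"
  shows "cmod ((backward_shift E w ^^ n) f v)
    \<le> real (level_card V E rt (depth V E rt v + n)) * Phi p (depth V E rt v + n)
        * (MAX u\<in>Chi_iter E n v. cmod (path_weight V E w v u))
        * (\<Sum>j. Ces_term V E rt p f (j + (depth V E rt v + n))) powr (1 / p)"
proof -
  let ?m = "depth V E rt v + n"
  let ?M = "MAX u\<in>Chi_iter E n v. cmod (path_weight V E w v u)"
  have fin: "finite (Chi_iter E n v)" and sub: "Chi_iter E n v \<subseteq> level V E rt ?m"
    using finite_Chi_iter[OF assms(1,5)] Chi_iter_trans[OF in_Chi_iter_depth[OF assms(5)]]
    by (auto simp: level_eq_Chi_iter)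
  have M: "cmod (path_weight V E w v u) \<le> ?M" if "u \<in> Chi_iter E n v" for u
    using fin that by (intro Max_ge) auto
  obtain u0 where "u0 \<in> Chi_iter E n v" using Chi_iter_nonempty[OF assms(2,5)] by blast
  then have M0: "?M \<ge> 0" using M[of u0] norm_ge_zero order_trans by blast
  have "cmod ((backward_shift E w ^^ n) f v)
      = cmod (\<Sum>u\<in>Chi_iter E n v. path_weight V E w v u * f u)"
    by (simp add: backward_shift_funpow[OF assms(1,5)])
  also have "\<dots> \<le> (\<Sum>u\<in>Chi_iter E n v. ?M * cmod (f u))"
    using M by (intro sum_norm_le) (simp add: norm_mult mult_right_mono)
  also have "\<dots> = ?M * (\<Sum>u\<in>Chi_iter E n v. cmod (f u))"
    by (simp add: sum_distrib_left)
  also have "\<dots> \<le> ?M * (\<Sum>u\<in>level V E rt ?m. cmod (f u))"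
    using sub M0 by (intro mult_left_mono sum_mono2 finite_level assms) auto
  also have "\<dots> = ?M * (real (level_card V E rt ?m) * level_mean V E rt ?m f)"
    by (simp only: sum_level_eq[OF assms(1,2)])
  also have "\<dots> \<le> ?M * (real (level_card V E rt ?m)
      * (Phi p ?m * (\<Sum>j. Ces_term V E rt p f (j + ?m)) powr (1 / p)))"
    using M0 by (intro mult_left_mono level_mean_le_Phi_tail assms) auto
  finally show ?thesis by (simp add: mult_ac)
qed

lemma limit_point_imp_weights_unbounded:
  assumes "locally_finite_tree V E" "leafless_tree V E" "1 < p"
    and bop: "bounded_operator_on (Ces V E rt p) (Ces_norm V E rt p) (backward_shift E w)"
    and "has_nonzero_orbit_limit_point (Ces V E rt p) (Ces_norm V E rt p) (backward_shift E w)"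
  shows "\<exists>v\<in>V. \<exists>n :: nat \<Rightarrow> nat. strict_mono n \<and> (\<forall>k. n k > 0) \<and>
    filterlim
      (\<lambda>k. real (level_card V E rt (depth V E rt v + n k)) * Phi p (depth V E rt v + n k)
          * (MAX u\<in>Chi_iter E (n k) v. cmod (path_weight V E w v u)))
      at_top sequentially"
proof -
  let ?B = "backward_shift E w" and ?N = "Ces_norm V E rt p"
  obtain C where B: "\<And>n f. f \<in> Ces V E rt p \<Longrightarrow> (?B ^^ n) f \<in> Ces V E rt p"
    using bounded_operator_funpow[OF bop Ces_norm_nonneg] by blast
  obtain f g n where f: "f \<in> Ces V E rt p" and g: "g \<in> Ces V E rt p" "g \<noteq> (\<lambda>_. 0)"
    and n: "strict_mono n" "\<forall>k. n k > (0 :: nat)"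
    and lim: "(\<lambda>k. ?N (\<lambda>v. (?B ^^ n k) f v - g v)) \<longlonglongrightarrow> 0"
    using assms(5) by (auto simp: has_nonzero_orbit_limit_point_def orbit_limit_points_def)
  obtain v where "g v \<noteq> 0" using g(2) by auto
  then have v: "v \<in> V" using g(1) by (auto simp: Ces_def)
  let ?d = "depth V E rt v"
  let ?q = "\<lambda>k. real (level_card V E rt (?d + n k)) * Phi p (?d + n k)
    * (MAX u\<in>Chi_iter E (n k) v. cmod (path_weight V E w v u))"
  define t where "t = (\<lambda>N. (\<Sum>j. Ces_term V E rt p f (j + N)) powr (1 / p))"
  have t0: "(\<lambda>k. t (?d + n k)) \<longlonglongrightarrow> 0"
  proof -
    have "strict_mono (\<lambda>k. ?d + n k)" using n(1) by (auto simp: strict_mono_def)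
    then show ?thesis
      using LIMSEQ_subseq_LIMSEQ[OF Ces_tail_tendsto_0[OF assms(3) f]] by (simp add: t_def o_def)
  qed
  have "(\<lambda>k. (?B ^^ n k) f v - g v) \<longlonglongrightarrow> 0"
  proof (rule Lim_null_comparison[OF always_eventually])
    let ?c = "real (level_card V E rt ?d) * Phi p ?d"
    show "\<forall>k. cmod ((?B ^^ n k) f v - g v) \<le> ?c * ?N (\<lambda>v. (?B ^^ n k) f v - g v)"
      using Ces_point_bound[OF assms(1-3) Ces_diff[OF _ B[OF f] g(1)] v] assms(3) by simp
    show "(\<lambda>k. ?c * ?N (\<lambda>v. (?B ^^ n k) f v - g v)) \<longlonglongrightarrow> 0"
      using tendsto_mult_right_zero[OF lim] .
  qed
  then have "(\<lambda>k. cmod ((?B ^^ n k) f v)) \<longlonglongrightarrow> cmod (g v)"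
    by (intro tendsto_norm) (simp add: LIM_zero_iff)
  then have low: "\<forall>\<^sub>F k in sequentially. cmod (g v) / 2 < cmod ((?B ^^ n k) f v)"
    using \<open>g v \<noteq> 0\<close> by (intro order_tendstoD) auto
  have "filterlim ?q at_top sequentially"
    unfolding filterlim_at_top_gt[where c = 0]
  proof (intro allI impI)
    fix Z :: real assume Z: "Z > 0"
    have "\<forall>\<^sub>F k in sequentially. t (?d + n k) < cmod (g v) / (2 * Z)"
      using t0 \<open>g v \<noteq> 0\<close> Z by (intro order_tendstoD(2)[OF t0]) simp
    with low show "\<forall>\<^sub>F k in sequentially. Z \<le> ?q k"
    proof eventually_elim
      case (elim k)
      have t_nn: "t (?d + n k) \<ge> 0" by (simp add: t_def)
      have "cmod (g v) / 2 < ?q k * t (?d + n k)"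
        using elim(1) funpow_shift_bound[OF assms(1-3) f v, where n = "n k" and w = w]
        by (simp add: t_def)
      also have "?q k * t (?d + n k) < Z * (cmod (g v) / (2 * Z))" if "?q k < Z"
      proof -
        have "?q k * t (?d + n k) \<le> Z * t (?d + n k)"
          using that t_nn by (intro mult_right_mono) auto
        also have "\<dots> < Z * (cmod (g v) / (2 * Z))"
          using elim(2) Z by (intro mult_strict_left_mono) auto
        finally show ?thesis .
      qed
      ultimately show ?case using Z by (cases "?q k < Z") (simp_all add: field_simps)
    qed
  qed
  then show ?thesis using v n by blast
qed

text \<open>
  Prolonging the paths backwards to the root changes the weights only by the nonzero factor
  \<open>\<lambda>(o \<rightarrow> v)\<close>.
\<close>

lemma weights_unbounded_at_root:
  assumes "locally_finite_tree V E" "leafless_tree V E" "1 < p" "\<forall>u \<in> V - {rt}. w u \<noteq> 0"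
    and v: "v \<in> V" and n: "strict_mono n" "\<forall>k. n k > (0 :: nat)"
    and lim: "filterlim
      (\<lambda>k. real (level_card V E rt (depth V E rt v + n k)) * Phi p (depth V E rt v + n k)
          * (MAX u\<in>Chi_iter E (n k) v. cmod (path_weight V E w v u)))
      at_top sequentially"
  shows "\<exists>n :: nat \<Rightarrow> nat. strict_mono n \<and> (\<forall>k. n k > 0) \<and>
    filterlim
      (\<lambda>k. real (level_card V E rt (n k)) * Phi p (n k)
          * (MAX u\<in>Chi_iter E (n k) rt. cmod (path_weight V E w rt u)))
      at_top sequentially"
proof -
  let ?d = "depth V E rt v" and ?a = "cmod (path_weight V E w rt v)"
  let ?M = "\<lambda>n v. MAX u\<in>Chi_iter E n v. cmod (path_weight V E w v u)"
  have d: "v \<in> Chi_iter E ?d rt" by (rule in_Chi_iter_depth[OF v])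
  have a: "?a > 0" using path_weight_nonzero[OF d root_in assms(4)] by simp
  have le: "?a * ?M m v \<le> ?M (?d + m) rt" for m
  proof -
    have fin: "finite (Chi_iter E m v)" and sub: "Chi_iter E m v \<subseteq> V"
      using finite_Chi_iter[OF assms(1) v] by auto
    have "Chi_iter E m v \<noteq> {}" using Chi_iter_nonempty[OF assms(2) v] by blast
    then have "?M m v \<in> (\<lambda>u. cmod (path_weight V E w v u)) ` Chi_iter E m v"
      using fin by (intro Max_in) auto
    then obtain u where u: "u \<in> Chi_iter E m v" "?M m v = cmod (path_weight V E w v u)" by auto
    have "?a * ?M m v = cmod (path_weight V E w rt u)"
      using path_weight_trans[OF d u(1) v] sub u by (auto simp: norm_mult)
    also have "\<dots> \<le> ?M (?d + m) rt"
      using finite_Chi_iter[OF assms(1) root_in] Chi_iter_trans[OF d u(1)] by (intro Max_ge) auto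
    finally show ?thesis .
  qed
  have "filterlim (\<lambda>k. real (level_card V E rt (?d + n k)) * Phi p (?d + n k) * ?M (?d + n k) rt)
      at_top sequentially"
  proof (rule filterlim_at_top_mono)
    show "filterlim (\<lambda>k. ?a * (real (level_card V E rt (?d + n k)) * Phi p (?d + n k) * ?M (n k) v))
        at_top sequentially"
      by (rule filterlim_tendsto_pos_mult_at_top[OF tendsto_const a lim])
    show "\<forall>\<^sub>F k in sequentially. ?a * (real (level_card V E rt (?d + n k)) * Phi p (?d + n k) * ?M (n k) v)
        \<le> real (level_card V E rt (?d + n k)) * Phi p (?d + n k) * ?M (?d + n k) rt"
    proof (intro always_eventually allI)
      fix k
      have "real (level_card V E rt (?d + n k)) * Phi p (?d + n k) * (?a * ?M (n k) v)
          \<le> real (level_card V E rt (?d + n k)) * Phi p (?d + n k) * ?M (?d + n k) rt"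
        using Phi_pos[OF assms(3)] by (intro mult_left_mono le) (simp add: less_imp_le)
      then show "?a * (real (level_card V E rt (?d + n k)) * Phi p (?d + n k) * ?M (n k) v)
          \<le> real (level_card V E rt (?d + n k)) * Phi p (?d + n k) * ?M (?d + n k) rt"
        by (simp only: mult_ac)
    qed
  qed
  moreover have "strict_mono (\<lambda>k. ?d + n k)" "\<forall>k. ?d + n k > 0"
    using n by (auto simp: strict_mono_def)
  ultimately show ?thesis by (intro exI[of _ "\<lambda>k. ?d + n k"]) simp
qed

end

section \<open>A function whose orbit returns to the root\<close>

lemma sum_half_powers_from:
  "(\<Sum>j<M. if k \<le> j then (1 / 2 :: real) ^ j else 0) \<le> 2 * (1 / 2) ^ k"
proof -
  have "(\<Sum>j<M. if k \<le> j then (1 / 2 :: real) ^ j else 0)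
      = (if k \<le> M then 2 * (1 / 2) ^ k - 2 * (1 / 2) ^ M else 0)"
    by (induction M) (auto simp: le_Suc_eq)
  then show ?thesis by simp
qed

context rooted_directed_tree
begin

text \<open>
  At most one vertex per level supports \<open>f\<close>, and \<open>f\<close> consists of the multiples \<open>f (u j) \<cdot> e\<^bsub>u j\<^esub>\<close> of
  unit functions, of norms at most \<open>K / 2 ^ (2 * j + 1)\<close>. One factor \<open>2 ^ (j + 1)\<close>
  is spent on splitting the \<open>p\<close>-th power of the sum, and the other makes the series converge.
\<close>

lemma sparse_in_Ces:
  assumes "locally_finite_tree V E" "leafless_tree V E" "1 < p" "K \<ge> 0"
    and r: "strict_mono (r :: nat \<Rightarrow> nat)" and u: "\<And>j. u j \<in> level V E rt (r j)"
    and supp: "\<And>v. f v \<noteq> 0 \<Longrightarrow> \<exists>j\<ge>k. v = u j"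
    and bound: "\<And>j. j \<ge> k \<Longrightarrow>
      cmod (f (u j)) \<le> K * (1 / 2) ^ (2 * j + 1) * (real (level_card V E rt (r j)) * Phi p (r j))"
  shows "f \<in> Ces V E rt p" "(\<Sum>n. Ces_term V E rt p f n) \<le> K powr p * (2 * (1 / 2) ^ k)"
proof -
  define b where "b j = K * (1 / 2) ^ (2 * j + 1) * Phi p (r j)" for j
  define y where "y n j = (if k \<le> j \<and> r j \<le> n then b j else 0)" for n j
  define z where "z n j = (if k \<le> j \<and> r j \<le> n
    then (K * (1 / 2) ^ j) powr p * (Phi p (r j) / (real n + 1)) powr p else 0)" for n j
  have b0: "b j \<ge> 0" for j using assms(4) Phi_pos[OF assms(3), of "r j"] by (simp add: b_def)
  have z0: "z n j \<ge> 0" for n j by (simp add: z_def)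
  have mean: "level_mean V E rt i f \<le> (\<Sum>j\<le>n. if k \<le> j \<and> r j = i then b j else 0)"
    if "i \<le> n" for i n
  proof (cases "\<exists>j\<ge>k. r j = i")
    case True
    then obtain j where j: "j \<ge> k" "r j = i" by blast
    have "j \<le> n" using seq_suble[OF r, of j] j that by simp
    have c: "real (level_card V E rt i) > 0" using level_card_pos[OF assms(1,2)] by simp
    have z: "f v = 0" if "v \<in> level V E rt i - {u j}" for v
    proof (rule ccontr)
      assume "f v \<noteq> 0"
      then obtain j' where j': "v = u j'" using supp by blast
      then have "r j' = r j" using that u[of j'] j by (auto simp: level_def)
      then show False using that j' strict_mono_eq[OF r] by auto
    qed
    have "(\<Sum>v\<in>level V E rt i. cmod (f v)) = (\<Sum>v\<in>{u j}. cmod (f v))"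
      using u[of j] j z by (intro sum.mono_neutral_right finite_level assms) auto
    then have "level_mean V E rt i f = cmod (f (u j)) / real (level_card V E rt i)"
      by (simp add: level_mean_def)
    also have "\<dots> \<le> b j"
      using bound[OF j(1)] c j by (simp add: b_def field_simps)
    also have "\<dots> = (\<Sum>j\<in>{j}. if k \<le> j \<and> r j = i then b j else 0)" using j by simp
    also have "\<dots> \<le> (\<Sum>j\<le>n. if k \<le> j \<and> r j = i then b j else 0)"
      using \<open>j \<le> n\<close> b0 by (intro sum_mono2) auto
    finally show ?thesis .
  next
    case False
    have "f v = 0" if "v \<in> level V E rt i" for v
    proof (rule ccontr)
      assume "f v \<noteq> 0"
      then obtain j where "j \<ge> k" "v = u j" using supp by blast
      then show False using that u[of j] False by (auto simp: level_def)
    qed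
    then have "level_mean V E rt i f = 0" by (simp add: level_mean_def)
    then show ?thesis using b0 by (simp add: sum_nonneg)
  qed
  have term_le: "Ces_term V E rt p f n \<le> (\<Sum>j\<le>n. z n j)" for n
  proof -
    have "(\<Sum>i=0..n. level_mean V E rt i f)
        \<le> (\<Sum>i=0..n. \<Sum>j\<le>n. if k \<le> j \<and> r j = i then b j else 0)"
      by (intro sum_mono mean) simp
    also have "\<dots> = (\<Sum>j\<le>n. \<Sum>i=0..n. if k \<le> j \<and> r j = i then b j else 0)"
      by (rule sum.swap)
    also have "\<dots> = (\<Sum>j\<le>n. y n j)"
    proof (intro sum.cong refl)
      fix j
      show "(\<Sum>i=0..n. if k \<le> j \<and> r j = i then b j else 0) = y n j"
        by (cases "k \<le> j") (simp_all add: y_def sum.delta')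
    qed
    finally have "1 / (real n + 1) * (\<Sum>i=0..n. level_mean V E rt i f)
        \<le> 1 / (real n + 1) * (\<Sum>j\<le>n. y n j)"
      by (intro mult_left_mono) auto
    also have "\<dots> = (\<Sum>j\<le>n. y n j / (real n + 1))" by (simp add: sum_divide_distrib)
    finally have "Ces_term V E rt p f n \<le> (\<Sum>j\<le>n. y n j / (real n + 1)) powr p"
      unfolding Ces_term_def using assms(3)
      by (intro powr_mono2) (auto intro!: mult_nonneg_nonneg sum_nonneg divide_nonneg_nonneg level_mean_nonneg)
    also have "\<dots> \<le> (\<Sum>j\<le>n. (2 ^ Suc j * (y n j / (real n + 1))) powr p)"
      using assms(3) b0 by (intro sum_powr_le_sum_geometric) (auto simp: y_def)
    also have "\<dots> = (\<Sum>j\<le>n. z n j)"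
    proof (intro sum.cong refl)
      fix j
      have split: "2 * j + 1 = Suc j + j" by simp
      have "(2 :: real) ^ Suc j * (1 / 2) ^ Suc j = 1"
        by (simp only: power_mult_distrib[symmetric]) simp
      then have half: "(2 :: real) ^ Suc j * (1 / 2) ^ (2 * j + 1) = (1 / 2) ^ j"
        unfolding split power_add mult.assoc[symmetric] by (simp only: mult_1_left)
      have "2 ^ Suc j * (b j / (real n + 1))
          = K * (2 ^ Suc j * (1 / 2) ^ (2 * j + 1)) * (Phi p (r j) / (real n + 1))"
        unfolding b_def divide_inverse by (simp only: mult_ac)
      then have "2 ^ Suc j * (b j / (real n + 1)) = K * (1 / 2) ^ j * (Phi p (r j) / (real n + 1))"
        by (simp only: half)
      then have "(2 ^ Suc j * (b j / (real n + 1))) powr p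
          = (K * (1 / 2) ^ j) powr p * (Phi p (r j) / (real n + 1)) powr p"
        by (simp only: powr_mult[of "K * (1 / 2) ^ j"])
      then show "(2 ^ Suc j * (y n j / (real n + 1))) powr p = z n j"
        unfolding y_def z_def by (auto simp only: split: if_split) simp_all
    qed
    finally show ?thesis .
  qed
  have partial: "(\<Sum>n<M. Ces_term V E rt p f n) \<le> K powr p * (2 * (1 / 2) ^ k)" for M
  proof -
    have "(\<Sum>n<M. Ces_term V E rt p f n) \<le> (\<Sum>n<M. \<Sum>j\<le>n. z n j)"
      by (intro sum_mono term_le)
    also have "\<dots> \<le> (\<Sum>n<M. \<Sum>j<M. z n j)"
      using z0 by (intro sum_mono sum_mono2) auto
    also have "\<dots> = (\<Sum>j<M. \<Sum>n<M. z n j)" by (rule sum.swap)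
    also have "\<dots> \<le> (\<Sum>j<M. K powr p * (if k \<le> j then (1 / 2) ^ j else 0))"
    proof (intro sum_mono)
      fix j
      show "(\<Sum>n<M. z n j) \<le> K powr p * (if k \<le> j then (1 / 2) ^ j else 0)"
      proof (cases "k \<le> j")
        case True
        have "(\<Sum>n<M. z n j) = (\<Sum>n\<in>{r j..<M}. z n j)"
          by (intro sum.mono_neutral_right) (auto simp: z_def)
        also have "\<dots> = (K * (1 / 2) ^ j) powr p
            * (\<Sum>n\<in>{r j..<M}. (Phi p (r j) / (real n + 1)) powr p)"
          using True by (simp add: z_def sum_distrib_left)
        also have "\<dots> \<le> (K * (1 / 2) ^ j) powr p"
          by (intro mult_left_le sum_Phi_div_powr_le_1 assms) auto
        also have "\<dots> = K powr p * ((1 / 2) ^ j) powr p" by (rule powr_mult)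
        also have "((1 / 2 :: real) ^ j) powr p \<le> ((1 / 2) ^ j) powr 1"
          using assms(3) by (intro powr_mono') (auto simp: power_le_one)
        finally show ?thesis using True by (simp add: mult_left_mono)
      qed (simp add: z_def)
    qed
    also have "\<dots> = K powr p * (\<Sum>j<M. if k \<le> j then (1 / 2) ^ j else 0)"
      by (simp only: sum_distrib_left)
    also have "\<dots> \<le> K powr p * (2 * (1 / 2) ^ k)"
      by (intro mult_left_mono sum_half_powers_from) auto
    finally show ?thesis .
  qed
  have s: "summable (Ces_term V E rt p f)"
    using Ces_term_nonneg partial by (rule summableI_nonneg_bounded)
  have "v \<in> V" if "f v \<noteq> 0" for v
    using supp[OF that] u by (auto simp: level_def)
  with s show "f \<in> Ces V E rt p" by (auto simp: Ces_def)
  show "(\<Sum>n. Ces_term V E rt p f n) \<le> K powr p * (2 * (1 / 2) ^ k)"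
    by (rule suminf_le_const[OF s partial])
qed

text \<open>
  Let \<open>u j\<close> be a vertex of maximal path weight on level \<open>r j\<close>. Then
  \<open>f = (\<Sum>j. (1 / \<lambda>(o \<rightarrow> u j)) \<cdot> e\<^bsub>u j\<^esub>)\<close> works, provided that the levels are sparse
  enough: the power \<open>r k\<close> of the shift kills the summands \<open>j < k\<close>, moves the summand \<open>j = k\<close> to
  \<open>e\<^sub>o\<close>, and expands the remaining ones by at most \<open>C ^ r k\<close>. The level \<open>r j\<close> is therefore chosen
  after \<open>r (j - 1)\<close>, with a summand of norm at most \<open>C ^ - r (j - 1) / 2 ^ (2 * j + 1)\<close>.
\<close>

lemma weights_unbounded_imp_root_limit_point:
  assumes "locally_finite_tree V E" "leafless_tree V E" "1 < p" "\<forall>u \<in> V - {rt}. w u \<noteq> 0"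
    and bop: "bounded_operator_on (Ces V E rt p) (Ces_norm V E rt p) (backward_shift E w)"
    and n: "strict_mono (n :: nat \<Rightarrow> nat)"
    and lim: "filterlim
      (\<lambda>k. real (level_card V E rt (n k)) * Phi p (n k)
          * (MAX u\<in>Chi_iter E (n k) rt. cmod (path_weight V E w rt u)))
      at_top sequentially"
  shows "\<exists>f\<in>Ces V E rt p.
    unit_fun rt \<in> orbit_limit_points (Ces V E rt p) (Ces_norm V E rt p) (backward_shift E w) f"
proof -
  let ?B = "backward_shift E w" and ?N = "Ces_norm V E rt p" and ?X = "Ces V E rt p"
  let ?pw = "path_weight V E w rt"
  define c where "c m = real (level_card V E rt m) * Phi p m" for m
  define q where "q m = c m * (MAX u\<in>Chi_iter E m rt. cmod (?pw u))" for m
  have c_pos: "c m > 0" for m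
    using level_card_pos[OF assms(1,2)] Phi_pos[OF assms(3)] by (simp add: c_def)
  obtain C where C1: "C \<ge> 1"
    and BX: "\<And>n f. f \<in> ?X \<Longrightarrow> (?B ^^ n) f \<in> ?X"
    and BN: "\<And>n f. f \<in> ?X \<Longrightarrow> ?N ((?B ^^ n) f) \<le> C ^ n * ?N f"
    using bounded_operator_funpow[OF bop Ces_norm_nonneg] by blast
  have "\<exists>u. u \<in> level V E rt m \<and> q m = c m * cmod (?pw u)" for m
  proof -
    have fin: "finite (Chi_iter E m rt)" and sub: "Chi_iter E m rt \<subseteq> V"
      using finite_Chi_iter[OF assms(1) root_in] by auto
    have "Chi_iter E m rt \<noteq> {}" using Chi_iter_nonempty[OF assms(2) root_in] by blast
    then have "(MAX u\<in>Chi_iter E m rt. cmod (?pw u)) \<in> (\<lambda>u. cmod (?pw u)) ` Chi_iter E m rt"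
      using fin by (intro Max_in) auto
    then show ?thesis using sub by (auto simp: q_def level_eq_Chi_iter)
  qed
  then obtain U where U: "\<And>m. U m \<in> level V E rt m" "\<And>m. q m = c m * cmod (?pw (U m))"
    by metis
  have pw0: "?pw x \<noteq> 0" if "x \<in> level V E rt m" for x m
    using that path_weight_nonzero[OF _ root_in assms(4)] by (auto simp: level_eq_Chi_iter)
  have large: "\<exists>y>m. q y \<ge> b" for b m
  proof -
    have "\<forall>\<^sub>F k in sequentially. b \<le> q (n k)"
      using lim by (simp add: filterlim_at_top q_def c_def)
    then have "\<forall>\<^sub>F k in sequentially. b \<le> q (n k) \<and> k > m"
      using eventually_gt_at_top by (rule eventually_conj)
    then obtain k where "b \<le> q (n k)" "k > m" by (auto simp: eventually_sequentially)
    then show ?thesis using seq_suble[OF n, of k] by (intro exI[of _ "n k"]) auto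
  qed
  have "\<exists>r. \<forall>j. (r j > 0 \<and> q (r j) \<ge> 2)
      \<and> (r j < r (Suc j) \<and> q (r (Suc j)) \<ge> 2 ^ (2 * Suc j + 1) * C ^ r j)"
  proof (rule dependent_nat_choice)
    show "\<exists>x>0. 2 \<le> q x" by (rule large)
    fix x j
    obtain y where y: "y > x" "q y \<ge> max 2 (2 ^ (2 * Suc j + 1) * C ^ x)" using large by blast
    then show "\<exists>y. (0 < y \<and> 2 \<le> q y) \<and> x < y \<and> 2 ^ (2 * Suc j + 1) * C ^ x \<le> q y"
      by (intro exI[of _ y]) auto
  qed
  then obtain r where r0: "\<And>j. r j > 0" "q (r 0) \<ge> 2"
    and rS: "\<And>j. r j < r (Suc j)" "\<And>j. q (r (Suc j)) \<ge> 2 ^ (2 * Suc j + 1) * C ^ r j"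
    by blast
  have r: "strict_mono r" using rS(1) by (simp add: strict_mono_Suc_iff)
  have q_tail: "q (r j) \<ge> 2 ^ (2 * j + 1) * C ^ r k" if kj: "Suc k \<le> j" for j k
  proof -
    obtain i where i: "j = Suc i" using kj by (cases j) auto
    then have "r k \<le> r i" using kj r by (simp add: strict_mono_less_eq)
    then have "2 ^ (2 * j + 1) * C ^ r k \<le> 2 ^ (2 * j + 1) * C ^ r i"
      using C1 by (intro mult_left_mono power_increasing) auto
    also have "\<dots> \<le> q (r j)" unfolding i by (rule rS(2))
    finally show ?thesis .
  qed
  have q_all: "q (r j) \<ge> 2 ^ (2 * j + 1)" for j
  proof (cases j)
    case (Suc i)
    have "(2 :: real) ^ (2 * j + 1) * 1 \<le> 2 ^ (2 * j + 1) * C ^ r 0"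
      using C1 by (intro mult_left_mono one_le_power) auto
    also have "\<dots> \<le> q (r j)" using Suc by (intro q_tail) simp
    finally show ?thesis by simp
  qed (use r0 in simp)
  have inv_bound: "cmod (1 / ?pw (U (r j))) \<le> K * (1 / 2) ^ (2 * j + 1) * c (r j)"
    if "q (r j) \<ge> 2 ^ (2 * j + 1) * (1 / K)" "K > 0" for j K
    using that pw0[OF U(1), of "r j"] U(2)[of "r j"]
    by (simp add: norm_divide field_simps power_one_over)

  \<comment> \<open>\<open>h k\<close> collects the summands \<open>j \<ge> k\<close>; the function sought is \<open>h 0\<close>.\<close>
  define h where "h k v = (if \<exists>j\<ge>k. v = U (r j) then 1 / ?pw v else 0)" for k :: nat and v
  have h_supp: "\<exists>j\<ge>k. v = U (r j)" if "h k v \<noteq> 0" for k v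
    using that by (auto simp: h_def split: if_splits)
  have h_U: "cmod (h k (U (r j))) = cmod (1 / ?pw (U (r j)))" if "j \<ge> k" for k j
    using that by (auto simp: h_def)
  have f_Ces: "h 0 \<in> ?X"
  proof (rule sparse_in_Ces(1)[OF assms(1-3) _ r U(1) h_supp])
    fix j :: nat
    show "cmod (h 0 (U (r j)))
        \<le> 1 * (1 / 2) ^ (2 * j + 1) * (real (level_card V E rt (r j)) * Phi p (r j))"
      using inv_bound[of j 1] q_all[of j] h_U[of 0 j] by (simp add: c_def)
  qed auto
  have tail_Ces: "h (Suc k) \<in> ?X"
    and tail_norm: "?N (h (Suc k)) \<le> 1 / C ^ r k * ((1 / 2) ^ k) powr (1 / p)" for k
  proof -
    have C0: "C ^ r k > 0" using C1 by simp
    have bnd: "cmod (h (Suc k) (U (r j)))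
        \<le> 1 / C ^ r k * (1 / 2) ^ (2 * j + 1) * (real (level_card V E rt (r j)) * Phi p (r j))"
      if "j \<ge> Suc k" for j
      using inv_bound[of j "1 / C ^ r k"] q_tail[OF that] h_U[OF that] C0 by (simp add: c_def)
    note sp = sparse_in_Ces[where k = "Suc k" and K = "1 / C ^ r k",
        OF assms(1-3) _ r U(1) h_supp bnd, simplified]
    show "h (Suc k) \<in> ?X" using C0 by (intro sp(1)) auto
    have "suminf (Ces_term V E rt p (h (Suc k))) \<le> (1 / C ^ r k) powr p * (1 / 2) ^ k"
      using sp(2) C0 by (simp add: less_imp_le)
    then have "?N (h (Suc k)) \<le> ((1 / C ^ r k) powr p * (1 / 2) ^ k) powr (1 / p)"
      unfolding Ces_norm_def using assms(3) \<open>h (Suc k) \<in> ?X\<close> Ces_term_nonneg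
      by (intro powr_mono2 suminf_nonneg) (auto simp: Ces_def)
    also have "\<dots> = ((1 / C ^ r k) powr p) powr (1 / p) * ((1 / 2) ^ k) powr (1 / p)"
      by (rule powr_mult)
    finally show "?N (h (Suc k)) \<le> 1 / C ^ r k * ((1 / 2) ^ k) powr (1 / p)"
      using assms(3) C0 by (simp add: powr_powr)
  qed
  have orbit: "(?B ^^ r k) (h 0) v - unit_fun rt v = (?B ^^ r k) (h (Suc k)) v" for k v
  proof (cases "v \<in> V")
    case False
    obtain m where m: "r k = Suc m" using r0(1)[of k] gr0_implies_Suc by blast
    have "Chi E v = {}" using False edges by (auto simp: Chi_def)
    then have "(?B ^^ r k) g v = 0" for g by (simp add: m backward_shift_def)
    then show ?thesis using False root_in by (auto simp: unit_fun_def)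
  next
    case True
    note formula = backward_shift_funpow[OF assms(1) True, where w = w and n = "r k"]
    show ?thesis
    proof (cases "v = rt")
      case False
      \<comment> \<open>Strictly below the root the descendants reached lie beyond level \<open>r k\<close>,
        where \<open>h 0\<close> and \<open>h (Suc k)\<close> agree.\<close>
      have "h 0 x = h (Suc k) x" if x: "x \<in> Chi_iter E (r k) v" for x
      proof -
        have "depth V E rt v > 0" using False True depth_0_iff by auto
        moreover have "x \<in> level V E rt (depth V E rt v + r k)"
          using Chi_iter_trans[OF in_Chi_iter_depth[OF True] x] finite_Chi_iter[OF assms(1) True] x
          by (auto simp: level_eq_Chi_iter)
        ultimately have "depth V E rt x > r k" by (simp add: level_def)
        then have "Suc k \<le> j" if "x = U (r j)" for j
          using U(1)[of "r j"] strict_mono_less[OF r, of k j] that by (auto simp: level_def)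
        then have "(\<exists>j\<ge>0. x = U (r j)) \<longleftrightarrow> (\<exists>j\<ge>Suc k. x = U (r j))" by blast
        then show ?thesis by (simp only: h_def)
      qed
      then show ?thesis using False by (simp add: formula unit_fun_def)
    next
      case True
      have lev: "Chi_iter E (r k) v = level V E rt (r k)"
        using finite_Chi_iter[OF assms(1) root_in, of "r k"] True by (auto simp: level_eq_Chi_iter)
      note at_root = formula[unfolded lev, unfolded True]
      have on_level: "j = k" if "x \<in> level V E rt (r k)" "x = U (r j)" for x j
      proof -
        have "r j = r k" using that U(1)[of "r j"] unfolding level_def by simp
        then show ?thesis using strict_mono_eq[OF r] by simp
      qed
      have "(?B ^^ r k) (h 0) v = (\<Sum>x\<in>level V E rt (r k). if x = U (r k) then 1 else 0)"
        unfolding True at_root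
      proof (intro sum.cong refl)
        fix x assume x: "x \<in> level V E rt (r k)"
        have "(\<exists>j\<ge>0. x = U (r j)) \<longleftrightarrow> x = U (r k)" using on_level[OF x] by blast
        then show "?pw x * h 0 x = (if x = U (r k) then 1 else 0)"
          using pw0[OF x] by (auto simp: h_def)
      qed
      also have "\<dots> = 1" using U(1) finite_level[OF assms(1)] by simp
      finally have "(?B ^^ r k) (h 0) v = 1" .
      moreover have "(?B ^^ r k) (h (Suc k)) v = 0"
        unfolding True at_root
      proof (intro sum.neutral ballI)
        fix x assume x: "x \<in> level V E rt (r k)"
        have "\<not> (\<exists>j\<ge>Suc k. x = U (r j))" using on_level[OF x] not_less_eq_eq by blast
        then show "?pw x * h (Suc k) x = 0" by (auto simp: h_def)
      qed
      ultimately show ?thesis using True by (simp add: unit_fun_def)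
    qed
  qed
  have "unit_fun rt = (\<lambda>v. (?B ^^ r 0) (h 0) v - (?B ^^ r 0) (h (Suc 0)) v)"
    using orbit[of 0] by (auto simp: fun_eq_iff algebra_simps)
  then have e: "unit_fun rt \<in> ?X"
    using Ces_diff[OF _ BX[OF f_Ces] BX[OF tail_Ces]] assms(3) by simp
  have "(\<lambda>k. ?N (\<lambda>v. (?B ^^ r k) (h 0) v - unit_fun rt v)) \<longlonglongrightarrow> 0"
  proof (rule tendsto_sandwich[OF _ _ tendsto_const])
    have "?N ((?B ^^ r k) (h (Suc k))) \<le> ((1 / 2) ^ k) powr (1 / p)" for k
    proof -
      have "?N ((?B ^^ r k) (h (Suc k))) \<le> C ^ r k * ?N (h (Suc k))" by (rule BN[OF tail_Ces])
      also have "\<dots> \<le> C ^ r k * (1 / C ^ r k * ((1 / 2) ^ k) powr (1 / p))"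
        using C1 by (intro mult_left_mono tail_norm) auto
      finally show ?thesis using C1 by simp
    qed
    then show "\<forall>\<^sub>F k in sequentially. ?N (\<lambda>v. (?B ^^ r k) (h 0) v - unit_fun rt v)
        \<le> ((1 / 2) ^ k) powr (1 / p)"
      by (simp add: orbit)
    show "(\<lambda>k. ((1 / 2 :: real) ^ k) powr (1 / p)) \<longlonglongrightarrow> 0"
      using assms(3) by (intro tendsto_zero_powrI[where b = "1 / p"] LIMSEQ_power_zero) auto
  qed (simp add: Ces_norm_nonneg)
  then have "unit_fun rt \<in> orbit_limit_points ?X ?N ?B (h 0)"
    unfolding orbit_limit_points_def using e r r0(1) by blast
  then show ?thesis using f_Ces by blast
qed

end

theorem theorem3p9:
  fixes V :: "'v set" and E :: "('v \<times> 'v) set" and rt :: 'v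
    and p :: real and w :: "'v \<Rightarrow> complex"
  assumes "1 < p"
    and "rooted_directed_tree V E rt"
    and "leafless_tree V E"
    and "locally_finite_tree V E"
    and "bounded_operator_on (Ces V E rt p) (Ces_norm V E rt p) (backward_shift E w)"
    and "\<forall>u \<in> V - {rt}. w u \<noteq> 0"
  shows
    "let X = Ces V E rt p; N = Ces_norm V E rt p; B = backward_shift E w;
         c = (\<lambda>m. real (level_card V E rt m));
         i = has_nonzero_orbit_limit_point X N B;
         ii = (\<exists>f\<in>X. unit_fun rt \<in> orbit_limit_points X N B f);
         iii = (\<exists>v\<in>V. \<exists>n :: nat \<Rightarrow> nat. strict_mono n \<and> (\<forall>k. n k > 0) \<and>
           filterlim
             (\<lambda>k. c (depth V E rt v + n k) * Phi p (depth V E rt v + n k)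
                 * (MAX u\<in>Chi_iter E (n k) v. cmod (path_weight V E w v u)))
             at_top sequentially);
         iv = (\<exists>n :: nat \<Rightarrow> nat. strict_mono n \<and> (\<forall>k. n k > 0) \<and>
           filterlim
             (\<lambda>k. c (n k) * Phi p (n k)
                 * (MAX u\<in>Chi_iter E (n k) rt. cmod (path_weight V E w rt u)))
             at_top sequentially)
     in (i \<longleftrightarrow> ii) \<and> (ii \<longleftrightarrow> iii) \<and> (iii \<longleftrightarrow> iv)"
proof -
  interpret rooted_directed_tree V E rt by (fact assms(2))
  let ?X = "Ces V E rt p" and ?N = "Ces_norm V E rt p" and ?B = "backward_shift E w"
  let ?grows = "\<lambda>(n :: nat \<Rightarrow> nat) d v. strict_mono n \<and> (\<forall>k. n k > 0) \<and>
    filterlim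
      (\<lambda>k. real (level_card V E rt (d + n k)) * Phi p (d + n k)
          * (MAX u\<in>Chi_iter E (n k) v. cmod (path_weight V E w v u)))
      at_top sequentially"
  let ?i = "has_nonzero_orbit_limit_point ?X ?N ?B"
  let ?ii = "\<exists>f\<in>?X. unit_fun rt \<in> orbit_limit_points ?X ?N ?B f"
  let ?iii = "\<exists>v\<in>V. \<exists>n. ?grows n (depth V E rt v) v"
  let ?iv = "\<exists>n :: nat \<Rightarrow> nat. strict_mono n \<and> (\<forall>k. n k > 0) \<and>
    filterlim
      (\<lambda>k. real (level_card V E rt (n k)) * Phi p (n k)
          * (MAX u\<in>Chi_iter E (n k) rt. cmod (path_weight V E w rt u)))
      at_top sequentially"
  have ii_i: "?ii \<Longrightarrow> ?i"
  proof -
    have "unit_fun rt \<noteq> (\<lambda>_. 0)" by (auto simp: unit_fun_def fun_eq_iff)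
    then show ?i if ?ii using that unfolding has_nonzero_orbit_limit_point_def by blast
  qed
  have i_iii: "?i \<Longrightarrow> ?iii"
    by (rule limit_point_imp_weights_unbounded[OF assms(4,3,1,5)])
  have iii_iv: "?iii \<Longrightarrow> ?iv"
    by (elim bexE exE conjE, rule weights_unbounded_at_root[OF assms(4,3,1,6)])
  have iv_ii: "?iv \<Longrightarrow> ?ii"
    by (elim exE conjE, rule weights_unbounded_imp_root_limit_point[OF assms(4,3,1,6,5)])
  have iv_iii: "?iv \<Longrightarrow> ?iii"
    by (rule bexI[of _ rt]) (simp_all only: depth_root add_0 root_in)
  have "?i \<longleftrightarrow> ?ii" by (rule iffI[OF iv_ii[OF iii_iv[OF i_iii]] ii_i])
  moreover have "?ii \<longleftrightarrow> ?iii" by (rule iffI[OF i_iii[OF ii_i] iv_ii[OF iii_iv]])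
  moreover have "?iii \<longleftrightarrow> ?iv" by (rule iffI[OF iii_iv iv_iii])
  ultimately show ?thesis unfolding Let_def by (intro conjI)
qed

end
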